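(* For an infinite number of values of the positive integer $n$, $\mu(n)>f(n)$, where $f(n)=\left\lceil \frac{1}{2}\left(\sqrt{4n-3}-1\right)\right\rceil$ and $\mu(n)$ is the $n$th mediation number.
   Context: Digraphs are finite, without loops or parallel arcs (both arcs $xy$ and $yx$ may be present). For a digraph $D$ and a vertex $x$, let $N^-(x)=\{y: yx\in A(D)\}$ and $N^-[x]=\{x\}\cup N^-(x)$; $\Delta^-(D)$ is the maximum of $|N^-(x)|$ over vertices $x$. A digraph $D$ is mediated if for every pair $x,y$ of distinct vertices there is a vertex $z$ (possibly $z=x$ or $z=y$) such that $x,y\in N^-[z]$. For $n\ge 1$, the $n$th mediation number $\mu(n)$ is the minimum of $\Delta^-(D)$ over all mediated digraphs $D$ on $n$ vertices. *)

theory Defs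
  imports Complex_Main "Graph_Theory.Pair_Digraph"
begin

definition in_nbrs :: "'a pair_pre_digraph \<Rightarrow> 'a \<Rightarrow> 'a set" where
  "in_nbrs D x = {y. (y, x) \<in> parcs D}"

definition closed_in_nbrs :: "'a pair_pre_digraph \<Rightarrow> 'a \<Rightarrow> 'a set" where
  "closed_in_nbrs D x = insert x (in_nbrs D x)"

text \<open>Only meaningful for digraphs with a nonempty finite vertex set.\<close>

definition max_in_degree :: "'a pair_pre_digraph \<Rightarrow> nat" where
  "max_in_degree D = Max ((\<lambda>x. card (in_nbrs D x)) ` pverts D)"

definition mediated :: "'a pair_pre_digraph \<Rightarrow> bool" where
  "mediated D \<longleftrightarrow>
     pair_digraph D \<and>
     (\<forall>x\<in>pverts D. \<forall>y\<in>pverts D. x \<noteq> y \<longrightarrow>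
        (\<exists>z\<in>pverts D. x \<in> closed_in_nbrs D z \<and> y \<in> closed_in_nbrs D z))"

text \<open>
  Vertices are taken to be natural numbers, which loses no generality: the lemma
  \<open>mediation_number_le\<close> below covers digraphs over an arbitrary vertex type.
  Only meaningful for \<open>n > 0\<close>.
\<close>

definition mediation_number :: "nat \<Rightarrow> nat" where
  "mediation_number n =
     (LEAST k. \<exists>D :: nat pair_pre_digraph. mediated D \<and> card (pverts D) = n \<and> max_in_degree D = k)"

lemma mediation_number_attained:
  "\<exists>D :: nat pair_pre_digraph.
     mediated D \<and> card (pverts D) = n \<and> max_in_degree D = mediation_number n"
proof -
  let ?K = "\<lparr>pverts = {..<n}, parcs = {(x, y). x < n \<and> y < n \<and> x \<noteq> y}\<rparr> :: nat pair_pre_digraph"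
  have fin: "finite {(x, y). x < n \<and> y < n \<and> x \<noteq> y}"
    by (rule finite_subset[of _ "{..<n} \<times> {..<n}"]) auto
  have "pair_digraph ?K"
    by unfold_locales (use fin in auto)
  then have "mediated ?K"
    unfolding mediated_def closed_in_nbrs_def in_nbrs_def by auto
  then have "\<exists>k. \<exists>D :: nat pair_pre_digraph.
      mediated D \<and> card (pverts D) = n \<and> max_in_degree D = k"
    by (intro exI[of _ "max_in_degree ?K"] exI[of _ ?K]) auto
  then show ?thesis
    unfolding mediation_number_def by (rule LeastI_ex)
qed

lemma mediation_number_le:
  fixes D :: "'a pair_pre_digraph"
  assumes "mediated D" "card (pverts D) = n"
  shows "mediation_number n \<le> max_in_degree D"
proof -
  interpret pair_digraph D using assms(1) by (simp add: mediated_def)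
  obtain h where h: "bij_betw h (pverts D) {..<n}"
    using pair_finite_verts assms(2) ex_bij_betw_finite_nat[of "pverts D"]
    by (auto simp: atLeast0LessThan)
  then have inj: "inj_on h (pverts D)" and img: "h ` pverts D = {..<n}"
    by (auto simp: bij_betw_def)
  define E :: "nat pair_pre_digraph" where
    "E = \<lparr>pverts = h ` pverts D, parcs = map_prod h h ` parcs D\<rparr>"
  have E: "pair_digraph E"
  proof
    fix e assume "e \<in> parcs E"
    then obtain u v where uv: "(u, v) \<in> parcs D" "e = (h u, h v)"
      by (auto simp: E_def)
    then have "u \<in> pverts D" "v \<in> pverts D" "u \<noteq> v"
      using wellformed' no_loops' by blast+
    then show "fst e \<in> pverts E" "snd e \<in> pverts E" "fst e \<noteq> snd e"
      using uv inj by (auto simp: E_def inj_on_def)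
  qed (auto simp: E_def)
  have nb: "in_nbrs E (h x) = h ` in_nbrs D x" if "x \<in> pverts D" for x
  proof
    show "in_nbrs E (h x) \<subseteq> h ` in_nbrs D x"
    proof
      fix y assume "y \<in> in_nbrs E (h x)"
      then obtain u v where uv: "(u, v) \<in> parcs D" "y = h u" "h x = h v"
        by (auto simp: E_def in_nbrs_def)
      then have "v = x" using inj that wellformed' by (auto simp: inj_on_def)
      then show "y \<in> h ` in_nbrs D x" using uv by (auto simp: in_nbrs_def)
    qed
    show "h ` in_nbrs D x \<subseteq> in_nbrs E (h x)"
      by (force simp: E_def in_nbrs_def)
  qed
  have "in_nbrs D x \<subseteq> pverts D" for x
    using wellformed' by (auto simp: in_nbrs_def)
  then have "card (in_nbrs E (h x)) = card (in_nbrs D x)" if "x \<in> pverts D" for x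
    using nb[OF that] inj by (metis card_image inj_on_subset)
  then have "(\<lambda>x. card (in_nbrs E x)) ` pverts E = (\<lambda>x. card (in_nbrs D x)) ` pverts D"
    by (simp add: E_def image_image cong: image_cong)
  then have deg: "max_in_degree E = max_in_degree D"
    by (simp add: max_in_degree_def)
  have cl: "closed_in_nbrs E (h x) = h ` closed_in_nbrs D x" if "x \<in> pverts D" for x
    by (simp add: closed_in_nbrs_def nb[OF that])
  have "mediated E"
    unfolding mediated_def
  proof (intro conjI ballI impI)
    fix a b assume ab: "a \<in> pverts E" "b \<in> pverts E" "a \<noteq> b"
    then obtain x y where xy: "x \<in> pverts D" "y \<in> pverts D" "a = h x" "b = h y" "x \<noteq> y"
      by (auto simp: E_def)
    then obtain z where "z \<in> pverts D" "x \<in> closed_in_nbrs D z" "y \<in> closed_in_nbrs D z"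
      using assms(1) by (auto simp: mediated_def)
    then show "\<exists>z\<in>pverts E. a \<in> closed_in_nbrs E z \<and> b \<in> closed_in_nbrs E z"
      using xy cl by (intro bexI[of _ "h z"]) (auto simp: E_def)
  qed (rule E)
  moreover have "card (pverts E) = n"
    by (simp add: E_def img)
  ultimately show ?thesis
    unfolding mediation_number_def using deg by (intro Least_le) blast
qed

end

theory Submission
  imports Defs "Jordan_Normal_Form.Determinant"
begin

text \<open>
  Take \<open>n = q(q + 1)\<close> with \<open>q mod 8 = 4\<close>, so that \<open>f(n) \<le> q\<close>. If all in-degrees were at most \<open>q\<close>,
  double counting would force every closed in-neighbourhood to have size \<open>q + 1\<close>, every vertex to
  lie in \<open>q + 1\<close> of them, and every vertex to have exactly one mate with which it shares two of
  them, sharing exactly one with each other vertex. Ordering the \<open>n = 2m\<close> vertices so that the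
  mate of vertex \<open>i < m\<close> is \<open>i + m\<close>, the incidence matrix \<open>N\<close> satisfies
  \<open>N N\<^sup>T = (A B; B A)\<close> with \<open>A = q I + J\<close> and \<open>B = I + J\<close>, where \<open>J\<close> is the all-ones matrix.
  Hence \<open>(det N)\<^sup>2 = det (A\<^sup>2 - B\<^sup>2) = (q\<^sup>2 - 1)\<^sup>m (q + 1)\<close>. As \<open>m\<close> is even, \<open>q + 1\<close> would be a
  square, contradicting \<open>(q + 1) mod 8 = 5\<close>. This determinant argument (as for the Bose--Connor
  theorem on divisible designs) avoids the Bruck--Ryser theorem.
\<close>

section \<open>Matrices \<open>c I + d J\<close>, with \<open>J\<close> the all-ones matrix\<close>

definition scalar_plus_const_mat :: "nat \<Rightarrow> 'a::comm_ring_1 \<Rightarrow> 'a \<Rightarrow> 'a mat" where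
  "scalar_plus_const_mat m c d = mat m m (\<lambda>(i, j). (if i = j then c else 0) + d)"

lemma scalar_plus_const_mat_carrier [simp]:
  "scalar_plus_const_mat m c d \<in> carrier_mat m m"
  by (simp add: scalar_plus_const_mat_def)

text \<open>Follows from \<open>J * J = m J\<close>. The symmetry in the two factors supplies the
  commutation that the block determinant formula requires.\<close>

lemma scalar_plus_const_mat_mult:
  "scalar_plus_const_mat m a d * scalar_plus_const_mat m b e =
     scalar_plus_const_mat m (a * b) (a * e + b * d + of_nat m * d * e)"
proof (rule eq_matI)
  fix i j
  assume "i < dim_row (scalar_plus_const_mat m (a * b) (a * e + b * d + of_nat m * d * e))"
    and "j < dim_col (scalar_plus_const_mat m (a * b) (a * e + b * d + of_nat m * d * e))"
  then have ij: "i < m" "j < m"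
    by (simp_all add: scalar_plus_const_mat_def)
  have "(\<Sum>k<m. ((if i = k then a else 0) + d) * ((if k = j then b else 0) + e)) =
      (\<Sum>k<m. if i = k then (if k = j then a * b else 0) else 0) + (\<Sum>k<m. if i = k then a * e else 0)
      + (\<Sum>k<m. if k = j then b * d else 0) + (\<Sum>k<m. d * e)"
    unfolding sum.distrib[symmetric] by (rule sum.cong) (auto simp: algebra_simps)
  also have "\<dots> = (if i = j then a * b else 0) + (a * e + b * d + of_nat m * d * e)"
    using ij by (simp add: algebra_simps)
  finally show "(scalar_plus_const_mat m a d * scalar_plus_const_mat m b e) $$ (i, j) =
      scalar_plus_const_mat m (a * b) (a * e + b * d + of_nat m * d * e) $$ (i, j)"
    using ij by (simp add: scalar_plus_const_mat_def scalar_prod_def atLeast0LessThan)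
qed (simp_all add: scalar_plus_const_mat_def)

text \<open>The matrix is similar to a lower triangular one that shows its eigenvalues:
  \<open>c + m d\<close> once, from the all-ones vector, and \<open>c\<close> a further
  \<open>m - 1\<close> times.\<close>

lemma det_scalar_plus_const_mat:
  fixes c d :: "'a::idom"
  assumes "m > 0"
  shows "det (scalar_plus_const_mat m c d) = c ^ (m - 1) * (c + of_nat m * d)"
proof -
  let ?M = "scalar_plus_const_mat m c d"
  define s where "s = c + of_nat m * d"
  \<comment> \<open>Adding all rows to the first row amounts to \<open>U * M = L * U\<close> with triangular \<open>U\<close> and \<open>L\<close>.\<close>
  define U :: "'a mat" where "U = mat m m (\<lambda>(i, j). if i = 0 \<or> i = j then 1 else 0)"
  define L where
    "L = mat m m (\<lambda>(i, j). if j = 0 then (if i = 0 then s else d) else if i = j then c else 0)"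
  have carr: "U \<in> carrier_mat m m" "L \<in> carrier_mat m m"
    by (simp_all add: U_def L_def)
  have diag: "(\<Prod>i = 0..<m. f i) = f 0 * (\<Prod>i = 1..<m. f i)" for f :: "nat \<Rightarrow> 'a"
    using assms by (simp add: prod.atLeast_Suc_lessThan)
  have "det U = prod_list (diag_mat U)"
    by (rule det_upper_triangular[OF _ carr(1)]) (auto simp: U_def upper_triangular_def)
  also have "\<dots> = 1"
    by (simp add: prod_list_diag_prod U_def)
  finally have U: "det U = 1" .
  have "det L = prod_list (diag_mat L)"
    by (rule det_lower_triangular[OF _ carr(2)]) (auto simp: L_def)
  also have "\<dots> = c ^ (m - 1) * s"
    using assms by (simp add: prod_list_diag_prod L_def diag)
  finally have L: "det L = c ^ (m - 1) * s" .
  have "U * ?M = L * U"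
  proof (rule eq_matI)
    fix i j assume "i < dim_row (L * U)" "j < dim_col (L * U)"
    then have ij: "i < m" "j < m"
      using carr by simp_all
    have UM: "(U * ?M) $$ (i, j) =
        (\<Sum>k<m. (if i = 0 \<or> i = k then 1 else 0) * ((if k = j then c else 0) + d))"
      using ij by (simp add: U_def scalar_plus_const_mat_def scalar_prod_def atLeast0LessThan)
    have LU: "(L * U) $$ (i, j) =
        (\<Sum>k<m. (if k = 0 then (if i = 0 then s else d) else if i = k then c else 0) *
          (if k = 0 \<or> k = j then 1 else 0))"
      using ij by (simp add: U_def L_def scalar_prod_def atLeast0LessThan)
    show "(U * ?M) $$ (i, j) = (L * U) $$ (i, j)"
    proof (cases "i = 0")
      case True
      \<comment> \<open>Row 0 of \<open>U * M\<close> holds the column sums of \<open>M\<close>, all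
        equal to \<open>s\<close>; row 0 of \<open>L * U\<close> is \<open>s\<close> times the
        all-ones row of \<open>U\<close>.\<close>
      have "(U * ?M) $$ (i, j) = s"
        unfolding UM using True ij by (simp add: sum.distrib s_def)
      moreover have "(L * U) $$ (i, j) = (\<Sum>k<m. if k = 0 then s else 0)"
        unfolding LU using True by (intro sum.cong) auto
      ultimately show ?thesis
        using assms by simp
    next
      case False
      have "(U * ?M) $$ (i, j) = (\<Sum>k<m. if i = k then (if k = j then c else 0) + d else 0)"
        unfolding UM using False by (intro sum.cong) auto
      moreover have "(L * U) $$ (i, j) =
          (\<Sum>k<m. (if k = 0 then d else 0) + (if i = k then (if k = j then c else 0) else 0))"
        unfolding LU using False by (intro sum.cong) auto
      ultimately show ?thesis
        using assms ij by (simp add: sum.distrib)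
    qed
  qed (use carr in \<open>simp_all add: scalar_plus_const_mat_def\<close>)
  then have "det ?M = det L"
    using det_mult[OF carr(1), of ?M] det_mult[OF carr(2) carr(1)] by (simp add: U)
  then show ?thesis
    using L by (simp add: s_def)
qed

section \<open>Ordering the vertices so that mates are \<open>m\<close> apart\<close>

lemma fixpoint_free_involution_enumeration:
  fixes V :: "'a::linorder set"
  assumes "finite V" and card: "card V = 2 * m"
    and s: "\<And>x. x \<in> V \<Longrightarrow> s x \<in> V \<and> s x \<noteq> x \<and> s (s x) = x"
  obtains e where "bij_betw e {..<2 * m} V"
    and "\<And>i. i < m \<Longrightarrow> s (e i) = e (i + m)"
proof -
  \<comment> \<open>The linear order selects one element from each orbit of \<open>s\<close>. These
    \<open>m\<close> elements are listed first, then their images in the same order.\<close>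
  define A where "A = {x \<in> V. x < s x}"
  have A: "finite A" "A \<subseteq> V" "A \<inter> s ` A = {}"
    using assms s by (auto simp: A_def)
  have V: "V = A \<union> s ` A"
  proof
    show "V \<subseteq> A \<union> s ` A"
    proof
      fix x assume x: "x \<in> V"
      show "x \<in> A \<union> s ` A"
      proof (cases "x < s x")
        case False
        then have "s x \<in> A"
          using s[OF x] by (auto simp: A_def)
        then show ?thesis
          using s[OF x] by (metis UnI2 imageI)
      qed (use x in \<open>simp add: A_def\<close>)
    qed
  qed (use s A in auto)
  have inj: "inj_on s A"
    using s A(2) by (metis inj_onI subsetD)
  have "card V = card A + card A"
    using V A card_Un_disjoint[of A "s ` A"] card_image[OF inj] by simp
  then have "card A = m"
    using card by simp
  then obtain h where h: "bij_betw h {..<m} A"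
    using ex_bij_betw_nat_finite[OF A(1)] by (auto simp: atLeast0LessThan)
  define e where "e i = (if i < m then h i else s (h (i - m)))" for i
  have "bij_betw e {..<m} A"
    using h by (rule bij_betw_cong[THEN iffD1, rotated]) (simp add: e_def)
  moreover have "bij_betw e {m..<2 * m} (s ` A)"
  proof -
    have "bij_betw (\<lambda>i. i - m) {m..<2 * m} {..<m}"
      by (rule bij_betw_byWitness[where f' = "\<lambda>i. i + m"]) auto
    from bij_betw_trans[OF bij_betw_trans[OF this h] inj_on_imp_bij_betw[OF inj]]
    show ?thesis
      by (rule bij_betw_cong[THEN iffD1, rotated]) (simp add: e_def)
  qed
  ultimately have "bij_betw e ({..<m} \<union> {m..<2 * m}) (A \<union> s ` A)"
    using A(3) by (rule bij_betw_combine)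
  moreover have "{..<m} \<union> {m..<2 * m} = {..<2 * m}"
    by auto
  ultimately have "bij_betw e {..<2 * m} V"
    using V by simp
  moreover have "s (e i) = e (i + m)" if "i < m" for i
    using that by (simp add: e_def)
  ultimately show ?thesis
    using that by blast
qed

section \<open>Double counting in coverings of pairs by blocks\<close>

lemma sum_joint_block_count:
  assumes "finite V" and "\<forall>z\<in>V. B z \<subseteq> V"
  shows "(\<Sum>y\<in>V. card {z \<in> V. x \<in> B z \<and> y \<in> B z}) = (\<Sum>z | z \<in> V \<and> x \<in> B z. card (B z))"
proof -
  have "(\<Sum>y\<in>V. card {z \<in> V. x \<in> B z \<and> y \<in> B z}) =
      (\<Sum>y\<in>V. \<Sum>z | z \<in> V \<and> x \<in> B z. if y \<in> B z then 1 else 0)"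
    using assms(1) by (intro sum.cong) (auto simp: sum.If_cases Int_def conj_ac)
  also have "\<dots> = (\<Sum>z | z \<in> V \<and> x \<in> B z. \<Sum>y\<in>V. if y \<in> B z then 1 else 0)"
    by (rule sum.swap)
  also have "\<dots> = (\<Sum>z | z \<in> V \<and> x \<in> B z. card (B z))"
  proof (rule sum.cong)
    fix z assume "z \<in> {z \<in> V. x \<in> B z}"
    then have "V \<inter> B z = B z"
      using assms(2) by auto
    then show "(\<Sum>y\<in>V. if y \<in> B z then 1 else 0) = card (B z)"
      using assms(1) by (simp add: sum.If_cases)
  qed simp
  finally show ?thesis .
qed

lemma sum_degree:
  assumes "finite V" and "\<forall>z\<in>V. B z \<subseteq> V"
  shows "(\<Sum>x\<in>V. card {z \<in> V. x \<in> B z}) = (\<Sum>z\<in>V. card (B z))"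
proof -
  have "(\<Sum>x\<in>V. card {z \<in> V. x \<in> B z}) = (\<Sum>x\<in>V. \<Sum>z\<in>V. if x \<in> B z then 1 else 0)"
    using assms(1) by (intro sum.cong) (auto simp: sum.If_cases Int_def)
  also have "\<dots> = (\<Sum>z\<in>V. \<Sum>x\<in>V. if x \<in> B z then 1 else 0)"
    by (rule sum.swap)
  also have "\<dots> = (\<Sum>z\<in>V. card (B z))"
  proof (rule sum.cong)
    fix z assume "z \<in> V"
    then have "V \<inter> B z = B z"
      using assms(2) by auto
    then show "(\<Sum>y\<in>V. if y \<in> B z then 1 else 0) = card (B z)"
      using assms(1) by (simp add: sum.If_cases)
  qed simp
  finally show ?thesis .
qed

lemma sum_eq_imp_pointwise_eq:
  fixes f g :: "'a \<Rightarrow> nat"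
  assumes "finite S" "\<And>x. x \<in> S \<Longrightarrow> f x \<le> g x" "sum g S \<le> sum f S" "x \<in> S"
  shows "f x = g x"
proof (rule ccontr)
  assume "f x \<noteq> g x"
  then have "f x < g x"
    using assms(2,4) by (simp add: order_less_le)
  then have "sum f S < sum g S"
    using assms by (intro sum_strict_mono_ex1) auto
  then show False
    using assms(3) by simp
qed

text \<open>A point in at most \<open>q\<close> blocks would meet at most \<open>q * q\<close> other
  points, fewer than \<open>q * (q + 1) - 1\<close>. So every degree is at least
  \<open>q + 1\<close>, while the block sizes bound the average degree by \<open>q + 1\<close>; all
  these estimates are therefore equalities.\<close>

lemma pair_covering_structure:
  fixes V :: "'a set" and q :: nat
  assumes fin: "finite V" and card: "card V = q * (q + 1)" and q: "q \<ge> 2"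
    and sub: "\<forall>z\<in>V. B z \<subseteq> V"
    and small: "\<forall>z\<in>V. card (B z) \<le> q + 1"
    and cover: "\<forall>x\<in>V. \<forall>y\<in>V. x \<noteq> y \<longrightarrow> (\<exists>z\<in>V. x \<in> B z \<and> y \<in> B z)"
    and x: "x \<in> V"
  shows "card {z \<in> V. x \<in> B z} = q + 1"
    and "\<exists>s\<in>V - {x}. \<forall>y\<in>V - {x}. card {z \<in> V. x \<in> B z \<and> y \<in> B z} = (if y = s then 2 else 1)"
proof -
  define r where "r x = card {z \<in> V. x \<in> B z}" for x
  define l where "l x y = card {z \<in> V. x \<in> B z \<and> y \<in> B z}" for x y
  have l_ge: "l x y \<ge> 1" if "x \<in> V" "y \<in> V" "x \<noteq> y" for x y
    using cover that fin by (auto simp: l_def Suc_le_eq card_gt_0_iff)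
  \<comment> \<open>The term \<open>y = x\<close> of the joint count is \<open>r x\<close>.\<close>
  have l_sum: "(\<Sum>y\<in>V - {x}. l x y) + r x = (\<Sum>z | z \<in> V \<and> x \<in> B z. card (B z))"
    if "x \<in> V" for x
    using sum_joint_block_count[OF fin sub, of x] sum.remove[OF fin that, where g = "l x"]
    by (simp add: l_def r_def)
  have r_ge: "r x \<ge> q + 1" if x: "x \<in> V" for x
  proof (rule ccontr)
    assume "\<not> r x \<ge> q + 1"
    then have "r x * q \<le> q * q"
      by simp
    have "q * (q + 1) - 1 = (\<Sum>y\<in>V - {x}. 1)"
      using fin x card by simp
    also have "\<dots> \<le> (\<Sum>y\<in>V - {x}. l x y)"
      using l_ge x by (intro sum_mono) auto
    finally have "q * (q + 1) - 1 + r x \<le> (\<Sum>z | z \<in> V \<and> x \<in> B z. card (B z))"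
      using l_sum[OF x] by simp
    also have "\<dots> \<le> (\<Sum>z | z \<in> V \<and> x \<in> B z. q + 1)"
      using small by (intro sum_mono) auto
    also have "\<dots> = r x * q + r x"
      by (simp add: r_def)
    finally show False
      using \<open>r x * q \<le> q * q\<close> q unfolding distrib_left by linarith
  qed
  have "(\<Sum>z\<in>V. card (B z)) \<le> (\<Sum>z\<in>V. q + 1)"
    using small by (intro sum_mono) auto
  moreover have "(\<Sum>x\<in>V. q + 1) \<le> (\<Sum>x\<in>V. r x)"
    using r_ge by (intro sum_mono) auto
  moreover have "(\<Sum>x\<in>V. r x) = (\<Sum>z\<in>V. card (B z))"
    using sum_degree[OF fin sub] by (simp add: r_def)
  ultimately have le: "(\<Sum>x\<in>V. r x) \<le> (\<Sum>x\<in>V. q + 1)" "(\<Sum>x\<in>V. q + 1) \<le> (\<Sum>z\<in>V. card (B z))"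
    by simp_all
  have r_eq: "r x = q + 1"
    using sum_eq_imp_pointwise_eq[OF fin _ le(1) x] r_ge by simp
  then show "card {z \<in> V. x \<in> B z} = q + 1"
    by (simp add: r_def)
  have B_eq: "card (B z) = q + 1" if "z \<in> V" for z
    using sum_eq_imp_pointwise_eq[OF fin _ le(2) that] small by simp
  have "(\<Sum>z | z \<in> V \<and> x \<in> B z. card (B z)) = r x * (q + 1)"
    by (simp add: B_eq r_def)
  then have l_total: "(\<Sum>y\<in>V - {x}. l x y) = q * (q + 1)"
    using l_sum[OF x] r_eq by (simp add: algebra_simps)
  \<comment> \<open>The \<open>q * (q + 1) - 1\<close> counts are positive and sum to
    \<open>q * (q + 1)\<close>, so the total excess over 1 is 1 and sits at a single point, the
    mate.\<close>
  moreover have "(\<Sum>y\<in>V - {x}. l x y) = (\<Sum>y\<in>V - {x}. (l x y - 1) + 1)"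
  proof (rule sum.cong)
    fix y assume "y \<in> V - {x}"
    then show "l x y = (l x y - 1) + 1"
      using l_ge[OF x, of y] by auto
  qed simp
  moreover have "\<dots> = (\<Sum>y\<in>V - {x}. l x y - 1) + (q * (q + 1) - 1)"
    using fin x card by (subst sum.distrib) simp
  moreover have "q * (q + 1) > 0"
    using q by simp
  ultimately have "(\<Sum>y\<in>V - {x}. l x y - 1) = 1"
    by linarith
  then obtain s where s: "s \<in> V - {x}" "l x s - 1 = 1"
      "\<forall>y\<in>V - {x}. s \<noteq> y \<longrightarrow> l x y - 1 = 0"
    using sum_eq_1_iff[of "V - {x}" "\<lambda>y. l x y - 1"] finite_Diff[OF fin] by blast
  have "l x y = (if y = s then 2 else 1)" if y: "y \<in> V - {x}" for y
  proof (cases "y = s")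
    case False
    then have "l x y - 1 = 0"
      using s(3) y by simp
    then show ?thesis
      using False l_ge[OF x, of y] y by force
  qed (use s(2) in simp)
  then show "\<exists>s\<in>V - {x}. \<forall>y\<in>V - {x}.
      card {z \<in> V. x \<in> B z \<and> y \<in> B z} = (if y = s then 2 else 1)"
    using s(1) by (auto simp: l_def)
qed

section \<open>Squares and the determinant of the incidence matrix\<close>

lemma is_square_if_sq_eq_sq_mult:
  fixes a b c :: int
  assumes "a ^ 2 = b ^ 2 * c" "b \<noteq> 0"
  shows "\<exists>k. c = k ^ 2"
proof -
  have "b ^ 2 dvd a ^ 2"
    using assms(1) by simp
  then have "b dvd a"
    by (simp add: pow_divides_pow_iff)
  then obtain k where "a = b * k" ..
  then have "b ^ 2 * k ^ 2 = b ^ 2 * c"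
    using assms(1) by (simp add: power_mult_distrib)
  then have "k ^ 2 = c"
    using assms(2) by simp
  then show ?thesis
    by blast
qed

lemma pair_covering_imp_square:
  fixes V :: "'a::linorder set" and q :: nat
  assumes fin: "finite V" and card: "card V = q * (q + 1)" and q: "q \<ge> 2"
    and four: "4 dvd q * (q + 1)"
    and sub: "\<forall>z\<in>V. B z \<subseteq> V"
    and small: "\<forall>z\<in>V. card (B z) \<le> q + 1"
    and cover: "\<forall>x\<in>V. \<forall>y\<in>V. x \<noteq> y \<longrightarrow> (\<exists>z\<in>V. x \<in> B z \<and> y \<in> B z)"
  shows "\<exists>k. int (q + 1) = k ^ 2"
proof -
  note struct = pair_covering_structure[OF fin card q sub small cover]
  define l where "l x y = card {z \<in> V. x \<in> B z \<and> y \<in> B z}" for x y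
  have "\<forall>x\<in>V. \<exists>s\<in>V - {x}. \<forall>y\<in>V - {x}. l x y = (if y = s then 2 else 1)"
    using struct(2) by (simp add: l_def)
  then obtain s where s: "\<And>x. x \<in> V \<Longrightarrow> s x \<in> V - {x}"
    and l: "\<And>x y. x \<in> V \<Longrightarrow> y \<in> V - {x} \<Longrightarrow> l x y = (if y = s x then 2 else 1)"
    by metis
  have l_sym: "l x y = l y x" for x y
    by (simp add: l_def conj_commute)
  \<comment> \<open>By symmetry \<open>s x\<close> shares two blocks with \<open>x\<close>, and only
    the mate of \<open>s x\<close> does so.\<close>
  have inv: "s (s x) = x" if "x \<in> V" for x
    using s[OF that] l[OF that s[OF that]] l[of "s x" x] that l_sym[of x "s x"]
    by (auto split: if_splits)
  have l_all: "l x y = (if x = y then q + 1 else if y = s x then 2 else 1)"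
    if "x \<in> V" "y \<in> V" for x y
    using l[OF that(1), of y] that(2) struct(1)[OF that(1)] by (auto simp: l_def)
  from four obtain t where t: "q * (q + 1) = 4 * t" ..
  \<comment> \<open>Half the number of points; it is even, so that an \<open>m\<close>-th power is
    the square of a \<open>t\<close>-th power.\<close>
  define m where "m = 2 * t"
  have m: "card V = 2 * m" "m > 0"
    using card t q by (auto simp: m_def intro: Nat.gr0I)
  obtain e where e: "bij_betw e {..<2 * m} V" and se: "\<And>i. i < m \<Longrightarrow> s (e i) = e (i + m)"
    using fixpoint_free_involution_enumeration[OF fin m(1), of s] s inv by blast
  have eV: "e i \<in> V" if "i < 2 * m" for i
    using e that by (auto simp: bij_betw_def)
  have e_eq: "e i = e j \<longleftrightarrow> i = j" if "i < 2 * m" "j < 2 * m" for i j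
    using e that by (auto simp: bij_betw_def inj_on_def)
  have se': "s (e (i + m)) = e i" if "i < m" for i
    using inv[OF eV, of i] se[OF that] that by simp
  have s_e: "e j = s (e i) \<longleftrightarrow> (if i < m then j = i + m else i = j + m)"
    if "i < 2 * m" "j < 2 * m" for i j
  proof (cases "i < m")
    case True
    then show ?thesis
      using that by (simp add: se e_eq)
  next
    case False
    then have "s (e i) = e (i - m)"
      using se'[of "i - m"] that by simp
    then show ?thesis
      using that False by (auto simp: e_eq)
  qed
  \<comment> \<open>Blocks are indexed by points, so \<open>e\<close> orders both rows and columns
    and \<open>N\<close> is square.\<close>
  define N :: "int mat" where
    "N = mat (2 * m) (2 * m) (\<lambda>(i, j). if e i \<in> B (e j) then 1 else 0)"
  have N: "N \<in> carrier_mat (2 * m) (2 * m)"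
    by (simp add: N_def)
  let ?A = "scalar_plus_const_mat m (int q) 1" and ?B = "scalar_plus_const_mat m (1::int) 1"
  \<comment> \<open>The entries are the joint counts: \<open>q + 1\<close> on the diagonal, 2 for
    mates, which lie on the diagonals of the off-diagonal blocks, and 1 elsewhere.\<close>
  have gram: "N * transpose_mat N = four_block_mat ?A ?B ?B ?A"
  proof (rule eq_matI)
    fix i j assume "i < dim_row (four_block_mat ?A ?B ?B ?A)" "j < dim_col (four_block_mat ?A ?B ?B ?A)"
    then have ij: "i < 2 * m" "j < 2 * m"
      by (simp_all add: scalar_plus_const_mat_def)
    have "(N * transpose_mat N) $$ (i, j) =
        (\<Sum>k<2 * m. if e i \<in> B (e k) \<and> e j \<in> B (e k) then 1 else 0)"
      using ij by (simp add: N_def scalar_prod_def atLeast0LessThan if_distrib cong: if_cong)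
        (auto intro!: sum.cong)
    also have "\<dots> = (\<Sum>z\<in>V. if e i \<in> B z \<and> e j \<in> B z then 1 else 0)"
      by (rule sum.reindex_bij_betw[OF e])
    also have "\<dots> = int (l (e i) (e j))"
      using fin by (simp add: sum.If_cases l_def Int_def)
    also have "\<dots> = four_block_mat ?A ?B ?B ?A $$ (i, j)"
      using ij by (subst l_all) (auto simp: eV e_eq s_e scalar_plus_const_mat_def)
    finally show "(N * transpose_mat N) $$ (i, j) = four_block_mat ?A ?B ?B ?A $$ (i, j)" .
  qed (simp_all add: N_def scalar_plus_const_mat_def)
  have "2 * int m = int (q * (q + 1))"
    unfolding t by (simp add: m_def)
  then have nt: "2 * int m = int q * (int q + 1)"
    by (simp add: algebra_simps)
  \<comment> \<open>The contributions \<open>m J\<close> of \<open>J * J\<close> cancel.\<close>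
  have diff: "?A * ?A - ?B * ?B = scalar_plus_const_mat m ((int q)^2 - 1) (2 * int q - 2)"
    unfolding scalar_plus_const_mat_mult
    by (rule eq_matI) (auto simp: scalar_plus_const_mat_def power2_eq_square)
  have "(det N)^2 = det (N * transpose_mat N)"
    using N by (subst det_mult[of _ "2 * m"]) (auto simp: det_transpose power2_eq_square)
  also have "\<dots> = det (?A * ?A - ?B * ?B)"
    unfolding gram by (rule det_four_block_mat[of _ m]) (auto simp: scalar_plus_const_mat_mult add_ac)
  also have "\<dots> = ((int q)^2 - 1) ^ (m - 1) * ((int q)^2 - 1 + int m * (2 * int q - 2))"
    unfolding diff using det_scalar_plus_const_mat[OF m(2)] by simp
  also have "(int q)^2 - 1 + int m * (2 * int q - 2) = (int q - 1) * (int q + 1 + 2 * int m)"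
    by (simp add: algebra_simps power2_eq_square)
  \<comment> \<open>As \<open>2 m = q (q + 1)\<close>, the factor \<open>q + 1 + 2 m\<close> equals
    \<open>(q + 1)^2\<close>.\<close>
  also have "\<dots> = ((int q)^2 - 1) * (int q + 1)"
    unfolding nt by (simp add: algebra_simps power2_eq_square)
  also have "((int q)^2 - 1) ^ (m - 1) * \<dots> = ((int q)^2 - 1) ^ m * (int q + 1)"
    using m(2) by (cases m) auto
  also have "((int q)^2 - 1) ^ m = (((int q)^2 - 1) ^ t)^2"
    by (simp add: m_def power_mult[symmetric] mult.commute)
  finally have *: "(det N)^2 = (((int q)^2 - 1) ^ t)^2 * int (q + 1)"
    by simp
  have "(int q)^2 \<noteq> 1"
    using q by (simp add: power2_eq_1_iff)
  then have "((int q)^2 - 1) ^ t \<noteq> 0"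
    by simp
  with * show ?thesis
    by (rule is_square_if_sq_eq_sq_mult)
qed

text \<open>The squares modulo 8 are 0, 1 and 4.\<close>

lemma square_mod_8_neq_5:
  fixes k :: int
  shows "k ^ 2 mod 8 \<noteq> 5"
proof -
  have "k mod 8 \<in> {0, 1, 2, 3, 4, 5, 6, 7}"
    by (simp, presburger)
  then have "(k mod 8)^2 mod 8 \<noteq> 5"
    by auto
  then show ?thesis
    by (simp add: power_mod)
qed

section \<open>Application to mediated digraphs\<close>

lemma mediation_number_gt:
  assumes q: "q mod 8 = 4"
  shows "mediation_number (q * (q + 1)) > q"
proof (rule ccontr)
  assume "\<not> mediation_number (q * (q + 1)) > q"
  then obtain D :: "nat pair_pre_digraph" where D: "mediated D"
    "card (pverts D) = q * (q + 1)" "max_in_degree D \<le> q"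
    using mediation_number_attained[of "q * (q + 1)"] by (metis not_less)
  interpret pair_digraph D
    using D(1) by (simp add: mediated_def)
  have q2: "q \<ge> 2"
    using q by (cases "q < 2") auto
  have nbrs: "in_nbrs D z \<subseteq> pverts D" for z
    using wellformed' by (auto simp: in_nbrs_def)
  \<comment> \<open>With closed in-neighbourhoods as blocks, mediation is the covering of pairs, and
    an in-degree of at most \<open>q\<close> gives block size at most \<open>q + 1\<close>.\<close>
  have "\<exists>k. int (q + 1) = k ^ 2"
  proof (rule pair_covering_imp_square[where V = "pverts D" and B = "closed_in_nbrs D"])
    have "4 dvd q"
      using q by presburger
    then show "4 dvd q * (q + 1)"
      by simp
    show "\<forall>z\<in>pverts D. closed_in_nbrs D z \<subseteq> pverts D"
      using nbrs by (auto simp: closed_in_nbrs_def)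
    show "\<forall>z\<in>pverts D. card (closed_in_nbrs D z) \<le> q + 1"
    proof
      fix z assume "z \<in> pverts D"
      then have "card (in_nbrs D z) \<le> max_in_degree D"
        unfolding max_in_degree_def by (intro Max_ge) auto
      then show "card (closed_in_nbrs D z) \<le> q + 1"
        using D(3) card_insert_le_m1[of "q + 1" "in_nbrs D z" z]
        by (simp add: closed_in_nbrs_def)
    qed
    show "\<forall>x\<in>pverts D. \<forall>y\<in>pverts D. x \<noteq> y \<longrightarrow>
        (\<exists>z\<in>pverts D. x \<in> closed_in_nbrs D z \<and> y \<in> closed_in_nbrs D z)"
      using D(1) by (simp add: mediated_def)
  qed (use D(2) q2 in auto)
  moreover have "int (q + 1) mod 8 = 5"
    using q by presburger
  ultimately show False
    using square_mod_8_neq_5 by metis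
qed

theorem corollary6p3:
  shows "infinite {n :: nat. n \<ge> 1 \<and>
    int (mediation_number n) > \<lceil>1 / 2 * (sqrt (4 * real n - 3) - 1)\<rceil>}"
  unfolding infinite_nat_iff_unbounded
proof
  fix b :: nat
  \<comment> \<open>This runs through the residue class 4 modulo 8 and makes \<open>n\<close> exceed
    \<open>b\<close>.\<close>
  define q where "q = 8 * b + 4"
  define n where "n = q * (q + 1)"
  \<comment> \<open>Here \<open>4 n - 3 = (2 q + 1)^2 - 4\<close>.\<close>
  have "sqrt (4 * real n - 3) \<le> 2 * real q + 1"
    by (rule real_le_lsqrt) (auto simp: n_def power2_eq_square algebra_simps)
  then have "\<lceil>1 / 2 * (sqrt (4 * real n - 3) - 1)\<rceil> \<le> int q"
    by (simp add: ceiling_le_iff)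
  moreover have "mediation_number n > q"
    unfolding n_def by (rule mediation_number_gt) (simp add: q_def)
  moreover have "n > b"
    by (simp add: n_def q_def algebra_simps)
  ultimately show "\<exists>n>b. n \<in> {n. n \<ge> 1 \<and>
      int (mediation_number n) > \<lceil>1 / 2 * (sqrt (4 * real n - 3) - 1)\<rceil>}"
    by (intro exI[of _ n]) auto
qed

end
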